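(* Let $\mathbb{G}=h_{11}dt\otimes dt+g_{ij}dx^i\otimes dx^j+h^{11}g_{ij}\delta y_1^i\otimes\delta y_1^j$ be the non-isotropic gravitational potential produced by the jet conformal Minkowski metric $F$. The local geometrical Einstein equations that govern $\mathbb{G}$, i.e. the local form in the adapted basis of the global equations $$\operatorname{Ric}(C\Gamma)-\frac{\operatorname{Sc}(C\Gamma)}{2}\mathbb{G}=\mathcal{K}\mathcal{T},$$ are given by $$R_{ij}-\frac R2g_{ij}=\mathcal{K}\mathcal{T}_{ij},$$ $$\begin{cases}-R\,h_{11}=2\mathcal{K}\mathcal{T}_{11},\quad0=\mathcal{T}_{1i},\quad0=\mathcal{T}_{i1},\quad0=\mathcal{T}_{(i)1}^{(1)},\\0=\mathcal{T}_{1(i)}^{\ (1)},\quad0=\mathcal{T}_{i(j)}^{\ (1)},\quad0=\mathcal{T}_{(i)j}^{(1)},\quad-R\,h^{11}g_{ij}=2\mathcal{K}\mathcal{T}_{(i)(j)}^{(1)(1)},\end{cases}$$ where $$R_{ij}=-2(\sigma_{ij}-\sigma_i\sigma_j)+\frac{1-\delta_{ij}}{3}\left[3\Delta\sigma+6\|\operatorname{grad}\sigma\|^2-2(\operatorname{div}D_\sigma)^2-\mathfrak{S}\right],$$ $$R=4e^{-2\sigma}\left[3\Delta\sigma+3\|\operatorname{grad}\sigma\|^2-(\operatorname{div}D_\sigma)^2-\mathfrak{S}\right].$$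
   Context: $h_{11}(t)>0$ is a smooth Riemannian metric on $\mathbb{R}$, $h^{11}=1/h_{11}$, $\varkappa_{11}^1=\frac{h^{11}}{2}\frac{dh_{11}}{dt}$. $M^4$ is a smooth 4-manifold with local coordinates $x=(x^1,\dots,x^4)$, and $\sigma$ is a smooth non-constant function on $M^4$. The 1-jet space $J^1(\mathbb{R},M^4)$ has local coordinates $(t,x,y)$, $y=(y_1^1,\dots,y_1^4)$. The jet conformal Minkowski metric is $F(t,x,y)=e^{\sigma(x)}\sqrt{h^{11}(t)}\sqrt{G_{11}(y)}$ with $G_{11}(y)=y_1^1y_1^2+y_1^1y_1^3+y_1^1y_1^4+y_1^2y_1^3+y_1^2y_1^4+y_1^3y_1^4$, on the domain $G_{11}(y)>0$; its fundamental metrical d-tensor is $g_{ij}=\frac{e^{2\sigma(x)}}{2}(1-\delta_{ij})$, with inverse $(g^{ij})$. Latin indices run from 1 to 4, the Einstein summation convention is used for an index repeated in upper and lower position, and $\delta^i_j,\delta_{ij}$ are Kronecker symbols. Notation: $\sigma_i=\partial\sigma/\partial x^i$, $\sigma_{ij}=\partial^2\sigma/\partial x^i\partial x^j$, $\Delta\sigma=\sigma_{11}+\sigma_{22}+\sigma_{33}+\sigma_{44}$, $\mathfrak{S}=\sum_{p,q=1}^4\sigma_{pq}$, $\|\operatorname{grad}\sigma\|^2=\sigma_1^2+\sigma_2^2+\sigma_3^2+\sigma_4^2$, $\operatorname{div}D_\sigma=\sigma_1+\sigma_2+\sigma_3+\sigma_4$, $S_{[1]1}=y_1^1+y_1^2+y_1^3+y_1^4$.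 The canonical nonlinear connection of $F$ has components $M_{(1)1}^{(i)}=-\varkappa_{11}^1y_1^i$, $N_{(1)j}^{(i)}=\sigma_jy_1^i+\sigma_my_1^m\delta_j^i+[\sigma_i-\frac13\operatorname{div}D_\sigma](S_{[1]1}-y_1^j)$. The adapted vector fields are $\frac{\delta}{\delta t}=\frac{\partial}{\partial t}+\varkappa_{11}^1y_1^p\frac{\partial}{\partial y_1^p}$, $\frac{\delta}{\delta x^i}=\frac{\partial}{\partial x^i}-N_{(1)i}^{(p)}\frac{\partial}{\partial y_1^p}$, $\frac{\partial}{\partial y_1^i}$, with dual basis $dt$, $dx^i$, $\delta y_1^i=dy_1^i-\varkappa_{11}^1y_1^idt+N_{(1)p}^{(i)}dx^p$. The Cartan canonical connection $C\Gamma$ is the linear connection $\nabla$ with adapted components $(\varkappa_{11}^1,G_{j1}^k=0,L_{jk}^i,C_{j(k)}^{i(1)}=0)$, $L_{jk}^i=\delta_j^i\sigma_k+\delta_k^i\sigma_j+(1-\delta_{jk})\sigma_i-\frac{1-\delta_{jk}}{3}\operatorname{div}D_\sigma$, i.e. $\nabla_{\delta/\delta t}$ sends $\frac{\delta}{\delta t}\mapsto\varkappa_{11}^1\frac{\delta}{\delta t}$, $\frac{\delta}{\delta x^j}\mapsto0$, $\frac{\partial}{\partial y_1^j}\mapsto-\varkappa_{11}^1\frac{\partial}{\partial y_1^j}$; $\nabla_{\delta/\delta x^k}$ sends $\frac{\delta}{\delta t}\mapsto0$, $\frac{\delta}{\delta x^j}\mapsto L_{jk}^i\frac{\delta}{\delta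 x^i}$, $\frac{\partial}{\partial y_1^j}\mapsto L_{jk}^i\frac{\partial}{\partial y_1^i}$; and $\nabla_{\partial/\partial y_1^k}$ annihilates all adapted basis fields. With $\mathbf{R}(X,Y)Z=\nabla_X\nabla_YZ-\nabla_Y\nabla_XZ-\nabla_{[X,Y]}Z$, the Ricci d-tensor $\operatorname{Ric}(C\Gamma)$ has adapted components $\operatorname{Ric}(X_A,X_B)=\operatorname{trace}\{Z\mapsto\mathbf{R}(Z,X_B)X_A\}$ for adapted basis fields $X_A,X_B$, and $\operatorname{Sc}(C\Gamma)$ is the trace of $\operatorname{Ric}(C\Gamma)$ with respect to $\mathbb{G}$. $\mathcal{K}\neq0$ is a constant (Einstein constant) and $\mathcal{T}$ (stress-energy d-tensor of matter) is a $(0,2)$-tensor on the domain, written in the adapted cobasis as $$\begin{aligned}\mathcal{T}={}&\mathcal{T}_{11}dt\otimes dt+\mathcal{T}_{1i}dt\otimes dx^i+\mathcal{T}_{i1}dx^i\otimes dt+\mathcal{T}_{ij}dx^i\otimes dx^j+\mathcal{T}_{(i)1}^{(1)}\delta y_1^i\otimes dt+\mathcal{T}_{1(i)}^{\ (1)}dt\otimes\delta y_1^i\\&+\mathcal{T}_{i(j)}^{\ (1)}dx^i\otimes\delta y_1^j+\mathcal{T}_{(i)j}^{(1)}\delta y_1^i\otimes dx^j+\mathcal{T}_{(i)(j)}^{(1)(1)}\delta y_1^i\otimes\delta y_1^j.\end{aligned}$$ *)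

theory Defs
  imports "HOL-Analysis.Analysis"
begin

section \<open>Smooth maps and smooth manifolds\<close>

text \<open>\<open>Ck_on k f S\<close> is meant for open \<open>S\<close> in a finite-dimensional space:
  \<open>f\<close> is \<open>k\<close> times continuously differentiable on \<open>S\<close>.\<close>

fun Ck_on :: "nat \<Rightarrow> ('a::real_normed_vector \<Rightarrow> 'b::real_normed_vector) \<Rightarrow> 'a set \<Rightarrow> bool" where
  "Ck_on 0 f S \<longleftrightarrow> continuous_on S f"
| "Ck_on (Suc k) f S \<longleftrightarrow>
     (\<forall>x\<in>S. f differentiable (at x)) \<and> (\<forall>v. Ck_on k (\<lambda>x. frechet_derivative f (at x) v) S)"

definition smooth_map_on :: "('a::real_normed_vector \<Rightarrow> 'b::real_normed_vector) \<Rightarrow> 'a set \<Rightarrow> bool" where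
  "smooth_map_on f S \<longleftrightarrow> (\<forall>k. Ck_on k f S)"

text \<open>A chart is a pair of its domain and its coordinate map; the type \<open>'m\<close> is the whole manifold.\<close>

type_synonym 'm chart = "'m set \<times> ('m \<Rightarrow> real^4)"

definition smooth_atlas :: "'m::topological_space chart set \<Rightarrow> bool" where
  "smooth_atlas \<A> \<longleftrightarrow>
     (\<forall>(V, \<phi>) \<in> \<A>. open V \<and> open (\<phi> ` V) \<and> homeomorphism V (\<phi> ` V) \<phi> (inv_into V \<phi>)) \<and>
     (\<Union>(V, \<phi>) \<in> \<A>. V) = UNIV \<and>
     (\<forall>(V, \<phi>) \<in> \<A>. \<forall>(W, \<psi>) \<in> \<A>. smooth_map_on (\<psi> \<circ> inv_into V \<phi>) (\<phi> ` (V \<inter> W)))"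

definition smooth_function :: "'m chart set \<Rightarrow> ('m \<Rightarrow> real) \<Rightarrow> bool" where
  "smooth_function \<A> \<sigma> \<longleftrightarrow> (\<forall>(V, \<phi>) \<in> \<A>. smooth_map_on (\<sigma> \<circ> inv_into V \<phi>) (\<phi> ` V))"

section \<open>Coordinates on the 1-jet space\<close>

text \<open>Points \<open>(t, x, y)\<close> of the 1-jet space in local coordinates. The same type serves for tangent
  vectors, written in the natural basis of coordinate vector fields; a vector field maps
  points to tangent vectors.\<close>

type_synonym jet1 = "real \<times> (real^4) \<times> (real^4)"
type_synonym vfield = "jet1 \<Rightarrow> jet1"

definition kron :: "4 \<Rightarrow> 4 \<Rightarrow> real" where
  "kron i j = (if i = j then 1 else 0)"

definition pdiff :: "4 \<Rightarrow> (real^4 \<Rightarrow> real) \<Rightarrow> real^4 \<Rightarrow> real" where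
  "pdiff i f x = frechet_derivative f (at x) (axis i 1)"

definition dir_deriv :: "vfield \<Rightarrow> (jet1 \<Rightarrow> real) \<Rightarrow> jet1 \<Rightarrow> real" where
  "dir_deriv X f p = frechet_derivative f (at p) (X p)"

definition lie_bracket :: "vfield \<Rightarrow> vfield \<Rightarrow> vfield" where
  "lie_bracket X Y p = frechet_derivative Y (at p) (X p) - frechet_derivative X (at p) (Y p)"

definition G11 :: "real^4 \<Rightarrow> real" where
  "G11 y = y$1 * y$2 + y$1 * y$3 + y$1 * y$4 + y$2 * y$3 + y$2 * y$4 + y$3 * y$4"

definition S11 :: "real^4 \<Rightarrow> real" where
  "S11 y = y$1 + y$2 + y$3 + y$4"

definition jet_domain :: "(real^4) set \<Rightarrow> jet1 set" where
  "jet_domain U = {(t, x, y). x \<in> U \<and> G11 y > 0}"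

text \<open>Index set of the adapted basis: \<open>Time\<close> for \<open>\<delta>/\<delta>t\<close> (resp. \<open>dt\<close>), \<open>Hor i\<close> for \<open>\<delta>/\<delta>x\<^sup>i\<close>
  (resp. \<open>dx\<^sup>i\<close>), \<open>Ver i\<close> for \<open>\<partial>/\<partial>y\<^sup>i\<close> (resp. \<open>\<delta>y\<^sup>i\<close>).\<close>

datatype adapted = Time | Hor 4 | Ver 4

lemma UNIV_adapted: "(UNIV :: adapted set) = insert Time (range Hor \<union> range Ver)"
  by (auto intro: adapted.exhaust)

instance adapted :: finite
  by standard (simp add: UNIV_adapted)

lemma sum_adapted:
  fixes f :: "adapted \<Rightarrow> 'a::comm_monoid_add"
  shows "(\<Sum>A\<in>UNIV. f A) = f Time + ((\<Sum>i\<in>UNIV. f (Hor i)) + (\<Sum>i\<in>UNIV. f (Ver i)))"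
proof -
  have "(\<Sum>A\<in>UNIV. f A) = f Time + (\<Sum>A\<in>range Hor \<union> range Ver. f A)"
    unfolding UNIV_adapted by (subst sum.insert) auto
  also have "(\<Sum>A\<in>range Hor \<union> range Ver. f A) = (\<Sum>A\<in>range Hor. f A) + (\<Sum>A\<in>range Ver. f A)"
    by (rule sum.union_disjoint) auto
  also have "(\<Sum>A\<in>range Hor. f A) = (\<Sum>i\<in>UNIV. f (Hor i))"
    by (subst sum.reindex) (auto simp: inj_on_def)
  also have "(\<Sum>A\<in>range Ver. f A) = (\<Sum>i\<in>UNIV. f (Ver i))"
    by (subst sum.reindex) (auto simp: inj_on_def)
  finally show ?thesis .
qed

section \<open>Geometry of the jet conformal Minkowski metric\<close>

text \<open>\<open>h\<close> is \<open>h\<^sub>1\<^sub>1\<close>, and \<open>s\<close> is the expression of \<open>\<sigma>\<close> in the local coordinates \<open>x\<close>.\<close>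

context
  fixes h :: "real \<Rightarrow> real" and s :: "real^4 \<Rightarrow> real"
begin

definition kap :: "real \<Rightarrow> real" where
  "kap t = (1 / h t) / 2 * deriv h t"

definition jet_F :: "jet1 \<Rightarrow> real" where
  "jet_F = (\<lambda>(t, x, y). exp (s x) * sqrt (1 / h t) * sqrt (G11 y))"

text \<open>The fundamental metrical d-tensor of \<open>F\<close> is
  \<open>g\<^sub>i\<^sub>j = (h\<^sub>1\<^sub>1 / 2) \<partial>\<^sup>2F\<^sup>2 / \<partial>y\<^sup>i\<partial>y\<^sup>j\<close>; its closed form is \<open>g_low_eq\<close> below.\<close>

definition g_low :: "4 \<Rightarrow> 4 \<Rightarrow> jet1 \<Rightarrow> real" where
  "g_low i j = (\<lambda>(t, x, y).
     h t / 2 * pdiff i (\<lambda>z. pdiff j (\<lambda>w. (jet_F (t, x, w))\<^sup>2) z) y)"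

definition s1 :: "4 \<Rightarrow> real^4 \<Rightarrow> real" where
  "s1 i = pdiff i s"

definition s2 :: "4 \<Rightarrow> 4 \<Rightarrow> real^4 \<Rightarrow> real" where
  "s2 i j = pdiff i (pdiff j s)"

definition Lap :: "real^4 \<Rightarrow> real" where
  "Lap x = s2 1 1 x + s2 2 2 x + s2 3 3 x + s2 4 4 x"

definition SS :: "real^4 \<Rightarrow> real" where
  "SS x = (\<Sum>p\<in>UNIV. \<Sum>q\<in>UNIV. s2 p q x)"

definition grad_sq :: "real^4 \<Rightarrow> real" where
  "grad_sq x = (s1 1 x)\<^sup>2 + (s1 2 x)\<^sup>2 + (s1 3 x)\<^sup>2 + (s1 4 x)\<^sup>2"

definition divD :: "real^4 \<Rightarrow> real" where
  "divD x = s1 1 x + s1 2 x + s1 3 x + s1 4 x"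

subsection \<open>Canonical nonlinear connection and adapted bases\<close>

definition M_conn :: "4 \<Rightarrow> jet1 \<Rightarrow> real" where
  "M_conn i = (\<lambda>(t, x, y). - kap t * y$i)"

definition N_conn :: "4 \<Rightarrow> 4 \<Rightarrow> jet1 \<Rightarrow> real" where
  "N_conn i j = (\<lambda>(t, x, y).
     s1 j x * y$i + (\<Sum>m\<in>UNIV. s1 m x * y$m) * kron i j + (s1 i x - 1/3 * divD x) * (S11 y - y$j))"

fun frame :: "adapted \<Rightarrow> vfield" where
  "frame Time p = (1, 0, - (\<chi> i. M_conn i p))"
| "frame (Hor j) p = (0, axis j 1, - (\<chi> i. N_conn i j p))"
| "frame (Ver j) p = (0, 0, axis j 1)"

fun coframe :: "adapted \<Rightarrow> jet1 \<Rightarrow> jet1 \<Rightarrow> real" where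
  "coframe Time p v = fst v"
| "coframe (Hor i) p v = fst (snd v) $ i"
| "coframe (Ver i) p v =
     snd (snd v) $ i + M_conn i p * fst v + (\<Sum>j\<in>UNIV. N_conn i j p * fst (snd v) $ j)"

subsection \<open>Cartan canonical connection\<close>

definition L_coeff :: "4 \<Rightarrow> 4 \<Rightarrow> 4 \<Rightarrow> real^4 \<Rightarrow> real" where
  "L_coeff i j k x =
     kron i j * s1 k x + kron i k * s1 j x + (1 - kron j k) * s1 i x - (1 - kron j k) / 3 * divD x"

text \<open>\<open>conn_frame A B\<close> is \<open>\<nabla>\<^bsub>X\<^sub>A\<^esub> X\<^sub>B\<close> for adapted basis fields; \<open>cartan_nabla\<close> is the linear
  connection with these values, i.e. their extension by additivity, function-linearity in
  the direction and the Leibniz rule.\<close>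

fun conn_frame :: "adapted \<Rightarrow> adapted \<Rightarrow> vfield" where
  "conn_frame Time Time p = kap (fst p) *\<^sub>R frame Time p"
| "conn_frame Time (Hor j) p = 0"
| "conn_frame Time (Ver j) p = - kap (fst p) *\<^sub>R frame (Ver j) p"
| "conn_frame (Hor k) Time p = 0"
| "conn_frame (Hor k) (Hor j) p = (\<Sum>i\<in>UNIV. L_coeff i j k (fst (snd p)) *\<^sub>R frame (Hor i) p)"
| "conn_frame (Hor k) (Ver j) p = (\<Sum>i\<in>UNIV. L_coeff i j k (fst (snd p)) *\<^sub>R frame (Ver i) p)"
| "conn_frame (Ver k) B p = 0"

definition cartan_nabla :: "vfield \<Rightarrow> vfield \<Rightarrow> vfield" where
  "cartan_nabla X Z p =
     (\<Sum>B\<in>UNIV. dir_deriv X (\<lambda>q. coframe B q (Z q)) p *\<^sub>R frame B p) +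
     (\<Sum>A\<in>UNIV. \<Sum>B\<in>UNIV. (coframe A p (X p) * coframe B p (Z p)) *\<^sub>R conn_frame A B p)"

definition curvature :: "vfield \<Rightarrow> vfield \<Rightarrow> vfield \<Rightarrow> vfield" where
  "curvature X Y Z p =
     cartan_nabla X (cartan_nabla Y Z) p - cartan_nabla Y (cartan_nabla X Z) p
     - cartan_nabla (lie_bracket X Y) Z p"

text \<open>The trace of \<open>Z \<mapsto> R(Z, X\<^sub>B)X\<^sub>A\<close> is that of its matrix in the adapted basis.\<close>

definition Ric_comp :: "adapted \<Rightarrow> adapted \<Rightarrow> jet1 \<Rightarrow> real" where
  "Ric_comp A B p =
     trace ((\<chi> C E. coframe C p (curvature (frame E) (frame B) (frame A) p)) :: real^adapted^adapted)"

definition Ric :: "jet1 \<Rightarrow> jet1 \<Rightarrow> jet1 \<Rightarrow> real" where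
  "Ric p u v = (\<Sum>A\<in>UNIV. \<Sum>B\<in>UNIV. Ric_comp A B p * coframe A p u * coframe B p v)"

subsection \<open>Gravitational potential and scalar curvature\<close>

definition grav_pot :: "jet1 \<Rightarrow> jet1 \<Rightarrow> jet1 \<Rightarrow> real" where
  "grav_pot p u v =
     h (fst p) * coframe Time p u * coframe Time p v
     + (\<Sum>i\<in>UNIV. \<Sum>j\<in>UNIV. g_low i j p * coframe (Hor i) p u * coframe (Hor j) p v)
     + (\<Sum>i\<in>UNIV. \<Sum>j\<in>UNIV. (1 / h (fst p)) * g_low i j p * coframe (Ver i) p u * coframe (Ver j) p v)"

definition grav_pot_matrix :: "jet1 \<Rightarrow> real^adapted^adapted" where
  "grav_pot_matrix p = (\<chi> A B. grav_pot p (frame A p) (frame B p))"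

definition Sc :: "jet1 \<Rightarrow> real" where
  "Sc p = (\<Sum>A\<in>UNIV. \<Sum>B\<in>UNIV. matrix_inv (grav_pot_matrix p) $ A $ B * Ric_comp A B p)"

subsection \<open>The closed expressions in the local Einstein equations\<close>

definition R_low :: "4 \<Rightarrow> 4 \<Rightarrow> real^4 \<Rightarrow> real" where
  "R_low i j x = - 2 * (s2 i j x - s1 i x * s1 j x)
     + (1 - kron i j) / 3 * (3 * Lap x + 6 * grad_sq x - 2 * (divD x)\<^sup>2 - SS x)"

definition R_scal :: "real^4 \<Rightarrow> real" where
  "R_scal x = 4 * exp (- 2 * s x) * (3 * Lap x + 3 * grad_sq x - (divD x)\<^sup>2 - SS x)"

subsection \<open>Consistency checks\<close>

lemma coframe_frame: "coframe A p (frame B p) = (if A = B then 1 else 0)"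
proof (cases A)
  case (Ver i)
  then show ?thesis
  proof (cases B)
    case (Hor j)
    have "(\<Sum>k\<in>UNIV. N_conn i k p * (axis j 1 :: real^4) $ k) = N_conn i j p"
      by (simp add: axis_def if_distrib cong: if_cong)
    then show ?thesis using Ver Hor by simp
  qed (simp_all add: axis_def)
qed (cases B; simp add: axis_def)+

lemma cartan_nabla_frame: "cartan_nabla (frame A) (frame B) p = conn_frame A B p"
proof -
  have "dir_deriv (frame A) (\<lambda>q. coframe C q (frame B q)) p = 0" for C
    by (simp add: coframe_frame dir_deriv_def)
  moreover have "((if C = A then 1 else 0) * (if E = B then 1 else 0)) *\<^sub>R conn_frame C E p
      = (if E = B then if C = A then conn_frame C B p else 0 else 0)" for C E
    by simp
  ultimately show ?thesis
    by (simp add: cartan_nabla_def coframe_frame)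
qed

lemma g_low_eq:
  assumes "h t > 0" "G11 y > 0"
  shows "g_low i j (t, x, y) = exp (2 * s x) / 2 * (1 - kron i j)"
proof -
  define c where "c = exp (2 * s x) / h t"
  have openG: "open {z. G11 z > 0}"
    unfolding G11_def by (intro open_Collect_less continuous_intros)
  have F2: "(jet_F (t, x, w))\<^sup>2 = c * G11 w" if "G11 w > 0" for w
    using that assms(1)
    by (simp add: jet_F_def c_def power_mult_distrib exp_double)
  have dG: "((\<lambda>w. c * G11 w) has_derivative (\<lambda>v. c * (\<Sum>k\<in>UNIV. (S11 z - z$k) * v$k))) (at z)" for z
    unfolding G11_def S11_def
    by (rule derivative_eq_intros bounded_linear_imp_has_derivative bounded_linear_vec_nth refl)+
      (simp add: fun_eq_iff sum_4 algebra_simps)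
  have 1: "pdiff j (\<lambda>w. (jet_F (t, x, w))\<^sup>2) z = c * (S11 z - z$j)" if "G11 z > 0" for z
  proof -
    have "((\<lambda>w. (jet_F (t, x, w))\<^sup>2) has_derivative (\<lambda>v. c * (\<Sum>k\<in>UNIV. (S11 z - z$k) * v$k))) (at z)"
      by (rule has_derivative_transform_within_open[OF dG openG]) (use that F2 in auto)
    then have "pdiff j (\<lambda>w. (jet_F (t, x, w))\<^sup>2) z = c * (\<Sum>k\<in>UNIV. (S11 z - z$k) * axis j 1 $ k)"
      unfolding pdiff_def by (simp add: frechet_derivative_at[symmetric])
    then show ?thesis
      by (simp add: axis_def if_distrib cong: if_cong)
  qed
  have dS: "((\<lambda>z. c * (S11 z - z$j)) has_derivative (\<lambda>v. c * (S11 v - v$j))) (at y)"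
    unfolding S11_def
    by (rule bounded_linear_imp_has_derivative)
      (intro bounded_linear_const_mult bounded_linear_sub bounded_linear_add bounded_linear_vec_nth)
  have "((\<lambda>z. pdiff j (\<lambda>w. (jet_F (t, x, w))\<^sup>2) z) has_derivative (\<lambda>v. c * (S11 v - v$j))) (at y)"
    by (rule has_derivative_transform_within_open[OF dS openG]) (use assms 1 in auto)
  then have "pdiff i (\<lambda>z. pdiff j (\<lambda>w. (jet_F (t, x, w))\<^sup>2) z) y = c * (S11 (axis i 1) - axis i 1 $ j)"
    unfolding pdiff_def[of i] by (simp add: frechet_derivative_at[symmetric])
  moreover have "S11 (axis i 1) = 1"
    using exhaust_4[of i] by (auto simp: S11_def axis_def)
  moreover have "(axis i 1 :: real^4) $ j = kron i j"
    by (simp add: axis_def kron_def)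
  ultimately show ?thesis
    using assms(1) by (simp add: g_low_def c_def)
qed

end

end

(* The coefficients L are the Christoffel symbols of the metric g(x), which is conformal to the flat
   metric (1 - kron) / 2. The adapted fields commute modulo vertical fields, and covariant derivatives
   in vertical directions kill the frame, so the bracket term drops out of the curvature of frame
   fields. Contracting the connection coefficients then leaves only the Ricci tensor of g in the
   horizontal block; with the explicit inverse of the potential this gives Sc = R. Both sides of the
   Einstein equations being bilinear, it suffices to compare them on the adapted frame. *)

theory Submission
  imports Defs
begin

section \<open>Symmetry of mixed second derivatives\<close>

section \<open>Second derivatives of smooth functions\<close>

lemma smooth_map_on_differentiable:
  assumes "smooth_map_on f S" "x \<in> S"
  shows "f differentiable (at x)"
proof -
  have "Ck_on (Suc 0) f S" using assms(1) unfolding smooth_map_on_def by blast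
  then show ?thesis using assms(2) by simp
qed

lemma smooth_map_on_frechet_derivative:
  assumes "smooth_map_on f S"
  shows "smooth_map_on (\<lambda>x. frechet_derivative f (at x) v) S"
  unfolding smooth_map_on_def
proof
  fix k
  have "Ck_on (Suc k) f S" using assms unfolding smooth_map_on_def by blast
  then show "Ck_on k (\<lambda>x. frechet_derivative f (at x) v) S" by simp
qed

lemma smooth_map_on_continuous_on:
  assumes "smooth_map_on f S"
  shows "continuous_on S f"
proof -
  have "Ck_on 0 f S" using assms unfolding smooth_map_on_def by blast
  then show ?thesis by simp
qed

lemma has_real_derivative_along_line:
  fixes f :: "'a::real_normed_vector \<Rightarrow> real"
  assumes "f differentiable (at (a + t *\<^sub>R u))"
  shows "((\<lambda>t. f (a + t *\<^sub>R u)) has_real_derivative frechet_derivative f (at (a + t *\<^sub>R u)) u) (at t)"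
proof -
  let ?D = "frechet_derivative f (at (a + t *\<^sub>R u))"
  have f: "(f has_derivative ?D) (at (a + t *\<^sub>R u))"
    using assms frechet_derivative_works by blast
  have "((\<lambda>t. a + t *\<^sub>R u) has_derivative (\<lambda>h. h *\<^sub>R u)) (at t)"
    by (auto intro!: derivative_eq_intros)
  from diff_chain_at[OF this f]
  have "((\<lambda>t. f (a + t *\<^sub>R u)) has_derivative (\<lambda>h. ?D (h *\<^sub>R u))) (at t)"
    by (simp add: o_def)
  moreover have "?D (h *\<^sub>R u) = ?D u * h" for h
    using linear_frechet_derivative[OF assms] by (simp add: linear_cmul)
  ultimately show ?thesis
    by (simp add: has_field_derivative_def)
qed

text \<open>The mean value theorem is applied twice, first along \<open>u\<close> and then along
  \<open>v\<close>. The second difference does not change when \<open>u\<close> and \<open>v\<close>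
  are swapped, while the derivative on the right does change its order; this is what yields
  symmetry.\<close>

lemma second_difference_mean_value:
  fixes f :: "'a::real_normed_vector \<Rightarrow> real"
  defines "g u \<equiv> \<lambda>x. frechet_derivative f (at x) u"
  assumes "0 < h"
    and in_S: "\<And>\<xi> \<eta>. 0 \<le> \<xi> \<Longrightarrow> \<xi> \<le> h \<Longrightarrow> 0 \<le> \<eta> \<Longrightarrow> \<eta> \<le> h \<Longrightarrow> x + \<xi> *\<^sub>R u + \<eta> *\<^sub>R v \<in> S"
    and df: "\<And>z. z \<in> S \<Longrightarrow> f differentiable (at z)"
    and dg: "\<And>z. z \<in> S \<Longrightarrow> g u differentiable (at z)"
  obtains \<xi> \<eta> where "0 < \<xi>" "\<xi> < h" "0 < \<eta>" "\<eta> < h"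
    "f (x + h *\<^sub>R u + h *\<^sub>R v) - f (x + h *\<^sub>R u) - f (x + h *\<^sub>R v) + f x
      = h * h * frechet_derivative (g u) (at (x + \<xi> *\<^sub>R u + \<eta> *\<^sub>R v)) v"
proof -
  \<comment> \<open>The increment of \<open>?k\<close> over the interval from 0 to \<open>h\<close>
    is the whole second difference.\<close>
  let ?k = "\<lambda>t. f ((x + h *\<^sub>R v) + t *\<^sub>R u) - f (x + t *\<^sub>R u)"
  have mem: "(x + h *\<^sub>R v) + t *\<^sub>R u \<in> S" "x + t *\<^sub>R u \<in> S" if "0 \<le> t" "t \<le> h" for t
    using in_S[of t h] in_S[of t 0] that \<open>0 < h\<close> by (simp_all add: add_ac)
  have "(?k has_real_derivative (g u ((x + h *\<^sub>R v) + t *\<^sub>R u) - g u (x + t *\<^sub>R u))) (at t)"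
    if "0 \<le> t" "t \<le> h" for t
    unfolding g_def
    by (intro DERIV_diff has_real_derivative_along_line df mem that)
  from MVT2[OF \<open>0 < h\<close> this] obtain \<xi> where \<xi>: "0 < \<xi>" "\<xi> < h"
    "?k h - ?k 0 = (h - 0) * (g u ((x + h *\<^sub>R v) + \<xi> *\<^sub>R u) - g u (x + \<xi> *\<^sub>R u))"
    by auto
  have "((\<lambda>t. g u ((x + \<xi> *\<^sub>R u) + t *\<^sub>R v)) has_real_derivative
      frechet_derivative (g u) (at ((x + \<xi> *\<^sub>R u) + t *\<^sub>R v)) v) (at t)" if "0 \<le> t" "t \<le> h" for t
    by (intro has_real_derivative_along_line dg in_S) (use \<xi> that in auto)
  from MVT2[OF \<open>0 < h\<close> this] obtain \<eta> where \<eta>: "0 < \<eta>" "\<eta> < h"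
    "g u ((x + \<xi> *\<^sub>R u) + h *\<^sub>R v) - g u ((x + \<xi> *\<^sub>R u) + 0 *\<^sub>R v)
      = (h - 0) * frechet_derivative (g u) (at ((x + \<xi> *\<^sub>R u) + \<eta> *\<^sub>R v)) v"
    by auto
  show thesis
    by (rule that[OF \<xi>(1,2) \<eta>(1,2)])
      (use \<xi>(3) \<eta>(3) in \<open>simp add: add_ac\<close>)
qed

text \<open>Schwarz's theorem. Close to \<open>x\<close> the same second difference equals
  \<open>h * h\<close> times a value of either mixed derivative, and both mixed derivatives are
  continuous at \<open>x\<close>.\<close>

lemma symmetric_second_frechet_derivative:
  fixes f :: "'a::real_normed_vector \<Rightarrow> real"
  assumes "open S" "x \<in> S" and f: "smooth_map_on f S"
  shows "frechet_derivative (\<lambda>z. frechet_derivative f (at z) u) (at x) v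
       = frechet_derivative (\<lambda>z. frechet_derivative f (at z) v) (at x) u"
proof -
  define D where "D u v z = frechet_derivative (\<lambda>z. frechet_derivative f (at z) u) (at z) v" for u v z
  have df: "\<And>z. z \<in> S \<Longrightarrow> f differentiable (at z)"
    by (rule smooth_map_on_differentiable[OF f])
  have dg: "\<And>w z. z \<in> S \<Longrightarrow> (\<lambda>z. frechet_derivative f (at z) w) differentiable (at z)"
    by (rule smooth_map_on_differentiable[OF smooth_map_on_frechet_derivative[OF f]])
  have cont: "isCont (D w w') x" for w w'
    using smooth_map_on_continuous_on[OF smooth_map_on_frechet_derivative
        [OF smooth_map_on_frechet_derivative[OF f], of w w']] assms(1,2)
    unfolding D_def by (simp add: continuous_on_eq_continuous_at)
  have "\<bar>D u v x - D v u x\<bar> \<le> e" if "e > 0" for e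
  proof -
    have "\<forall>\<^sub>F z in nhds x. z \<in> S \<and> \<bar>D u v z - D u v x\<bar> < e / 2 \<and> \<bar>D v u z - D v u x\<bar> < e / 2"
    proof (intro eventually_conj)
      have "(D w w' \<longlongrightarrow> D w w' x) (nhds x)" for w w'
        using cont[of w w'] by (simp add: isCont_def tendsto_at_iff_tendsto_nhds)
      from tendstoD[OF this, of "e / 2"] that
      show "\<forall>\<^sub>F z in nhds x. \<bar>D u v z - D u v x\<bar> < e / 2"
        and "\<forall>\<^sub>F z in nhds x. \<bar>D v u z - D v u x\<bar> < e / 2"
        by (simp_all only: dist_real_def half_gt_zero_iff)
      show "\<forall>\<^sub>F z in nhds x. z \<in> S"
        by (rule eventually_nhds_in_open[OF assms(1,2)])
    qed
    then obtain d where d: "d > 0" and near: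
      "\<And>z. dist z x < d \<Longrightarrow> z \<in> S \<and> \<bar>D u v z - D u v x\<bar> < e / 2 \<and> \<bar>D v u z - D v u x\<bar> < e / 2"
      unfolding eventually_nhds_metric by blast
    \<comment> \<open>With this step every point of the parallelogram spanned by
      \<open>h *\<^sub>R u\<close> and \<open>h *\<^sub>R v\<close> stays within distance
      \<open>d\<close> of \<open>x\<close>. The summand 1 keeps the denominator positive when
      \<open>u\<close> and \<open>v\<close> are zero.\<close>
    define h where "h = d / (norm u + norm v + 1)"
    have pos: "norm u + norm v + 1 > 0"
      by (smt (verit) norm_ge_zero)
    then have h: "h > 0" using d by (simp add: h_def)
    have close: "dist (x + a *\<^sub>R u + b *\<^sub>R v) x < d" if "0 \<le> a" "a \<le> h" "0 \<le> b" "b \<le> h" for a b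
    proof -
      have "dist (x + a *\<^sub>R u + b *\<^sub>R v) x \<le> a * norm u + b * norm v"
        using that norm_triangle_ineq[of "a *\<^sub>R u" "b *\<^sub>R v"] by (simp add: dist_norm)
      also have "\<dots> \<le> h * norm u + h * norm v"
        using that by (intro add_mono mult_right_mono) auto
      also have "\<dots> < h * (norm u + norm v + 1)"
        using h by (simp add: algebra_simps)
      also have "\<dots> = d" using pos by (simp add: h_def)
      finally show ?thesis .
    qed
    let ?dd = "f (x + h *\<^sub>R u + h *\<^sub>R v) - f (x + h *\<^sub>R u) - f (x + h *\<^sub>R v) + f x"
    obtain a b where ab: "0 < a" "a < h" "0 < b" "b < h"
      "?dd = h * h * D u v (x + a *\<^sub>R u + b *\<^sub>R v)"
      unfolding D_def
      by (rule second_difference_mean_value[OF h, of x u v S f]) (use near close df dg in auto)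
    have close': "dist (x + a *\<^sub>R v + b *\<^sub>R u) x < d" if "0 \<le> a" "a \<le> h" "0 \<le> b" "b \<le> h" for a b
      using close[of b a] that by (simp add: add_ac)
    obtain a' b' where ab': "0 < a'" "a' < h" "0 < b'" "b' < h"
      "f (x + h *\<^sub>R v + h *\<^sub>R u) - f (x + h *\<^sub>R v) - f (x + h *\<^sub>R u) + f x
        = h * h * D v u (x + a' *\<^sub>R v + b' *\<^sub>R u)"
      unfolding D_def
      by (rule second_difference_mean_value[OF h, of x v u S f]) (use near close' df dg in auto)
    have "h * h * D u v (x + a *\<^sub>R u + b *\<^sub>R v) = h * h * D v u (x + a' *\<^sub>R v + b' *\<^sub>R u)"
      using ab(5) ab'(5) by (simp only: add.commute[of "h *\<^sub>R v"] add.assoc)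
    then have "D u v (x + a *\<^sub>R u + b *\<^sub>R v) = D v u (x + a' *\<^sub>R v + b' *\<^sub>R u)"
      using h by simp
    then show ?thesis
      using near[OF close[of a b]] near[OF close'[of a' b']] ab ab' by (smt (verit) field_sum_of_halves)
  qed
  then have "\<bar>D u v x - D v u x\<bar> \<le> 0"
    by (rule field_le_epsilon) simp
  then show ?thesis by (simp add: D_def)
qed

section \<open>The connection in the adapted basis\<close>

section \<open>Adapted frames and connection coefficients\<close>

lemma linear_coframe: "linear (coframe h s A p)"
  by (cases A) (auto intro!: linearI simp: algebra_simps sum.distrib sum_distrib_left)

lemmas coframe_add = linear_add[OF linear_coframe]
  and coframe_diff = linear_diff[OF linear_coframe]
  and coframe_scaleR = linear_scale[OF linear_coframe]
  and coframe_neg = linear_neg[OF linear_coframe]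
  and coframe_sum = linear_sum[OF linear_coframe]
  and coframe_zero = linear_0[OF linear_coframe]

lemma sum_delta_mult:
  fixes f :: "'n::finite \<Rightarrow> real"
  shows "(\<Sum>k\<in>UNIV. (if k = i then 1 else 0) * f k) = f i"
    and "(\<Sum>k\<in>UNIV. (if i = k then 1 else 0) * f k) = f i"
  by (simp_all add: if_distrib[of "\<lambda>x. x * _"] cong: if_cong)

text \<open>The vertical covectors add exactly the terms of the nonlinear connection that the time
  and horizontal fields subtract, so these terms cancel.\<close>

lemma frame_expansion: "v = (\<Sum>A\<in>UNIV. coframe h s A p v *\<^sub>R frame h s A p)"
proof (rule prod_eqI)
  show "fst v = fst (\<Sum>A\<in>UNIV. coframe h s A p v *\<^sub>R frame h s A p)"
    by (simp add: sum_adapted fst_sum)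
  show "snd v = snd (\<Sum>A\<in>UNIV. coframe h s A p v *\<^sub>R frame h s A p)"
    by (rule prod_eqI)
      (simp_all add: sum_adapted snd_sum fst_sum vec_eq_iff axis_def
        if_distrib[of "\<lambda>x. _ * x"] sum_delta_mult algebra_simps sum.distrib sum_negf cong: if_cong)
qed

text \<open>The index order is direction, differentiated field, component.\<close>

definition conn_coeff :: "(real \<Rightarrow> real) \<Rightarrow> (real^4 \<Rightarrow> real) \<Rightarrow> adapted \<Rightarrow> adapted \<Rightarrow> adapted \<Rightarrow> jet1 \<Rightarrow> real"
  where "conn_coeff h s A B C p = coframe h s C p (conn_frame h s A B p)"

text \<open>Equations between functions rather than between values, so that they also rewrite under
  \<open>dir_deriv\<close>.\<close>

lemma conn_coeff_simps [simp]:
  "conn_coeff h s Time Time Time = (\<lambda>p. kap h (fst p))"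
  "conn_coeff h s Time Time (Hor i) = (\<lambda>p. 0)"
  "conn_coeff h s Time Time (Ver i) = (\<lambda>p. 0)"
  "conn_coeff h s Time (Hor j) C = (\<lambda>p. 0)"
  "conn_coeff h s Time (Ver j) Time = (\<lambda>p. 0)"
  "conn_coeff h s Time (Ver j) (Hor i) = (\<lambda>p. 0)"
  "conn_coeff h s Time (Ver j) (Ver i) = (\<lambda>p. - kap h (fst p) * kron i j)"
  "conn_coeff h s (Hor k) Time C = (\<lambda>p. 0)"
  "conn_coeff h s (Hor k) (Hor j) Time = (\<lambda>p. 0)"
  "conn_coeff h s (Hor k) (Hor j) (Hor i) = (\<lambda>p. L_coeff s i j k (fst (snd p)))"
  "conn_coeff h s (Hor k) (Hor j) (Ver i) = (\<lambda>p. 0)"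
  "conn_coeff h s (Hor k) (Ver j) Time = (\<lambda>p. 0)"
  "conn_coeff h s (Hor k) (Ver j) (Hor i) = (\<lambda>p. 0)"
  "conn_coeff h s (Hor k) (Ver j) (Ver i) = (\<lambda>p. L_coeff s i j k (fst (snd p)))"
  "conn_coeff h s (Ver k) B C = (\<lambda>p. 0)"
  by (simp_all add: fun_eq_iff conn_coeff_def coframe_sum coframe_scaleR coframe_neg coframe_zero coframe_frame
      kron_def if_distrib cong: if_cong del: coframe.simps frame.simps)

text \<open>Leibniz rule for the second covariant derivative: the field
  \<open>conn_frame h s B A\<close> has components \<open>conn_coeff h s B A C\<close>, which are
  first differentiated and then multiplied by the coefficients of the connection along
  \<open>E\<close>.\<close>

lemma cartan_nabla_conn_frame:
  "coframe h s D p (cartan_nabla h s (frame h s E) (conn_frame h s B A) p)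
    = dir_deriv (frame h s E) (conn_coeff h s B A D) p
      + (\<Sum>C\<in>UNIV. conn_coeff h s B A C p * conn_coeff h s E C D p)"
  (is "_ = _ + ?quad")
proof -
  have 1: "(\<lambda>q. coframe h s C q (conn_frame h s B A q)) = conn_coeff h s B A C" for C
    by (simp add: conn_coeff_def fun_eq_iff)
  have 2: "(\<Sum>F\<in>UNIV. \<Sum>C\<in>UNIV. coframe h s F p (frame h s E p) * conn_coeff h s B A C p * conn_coeff h s F C D p) = ?quad"
    by (simp add: coframe_frame sum_delta_mult mult.assoc flip: sum_distrib_left del: coframe.simps frame.simps)
  have 3: "(\<Sum>C\<in>UNIV. dir_deriv (frame h s E) (conn_coeff h s B A C) p * coframe h s D p (frame h s C p))
      = dir_deriv (frame h s E) (conn_coeff h s B A D) p"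
    by (simp add: coframe_frame if_distrib[of "\<lambda>x. _ * x"] cong: if_cong del: coframe.simps frame.simps)
  show ?thesis
    unfolding cartan_nabla_def coframe_add coframe_sum coframe_scaleR 1 real_scaleR_def 3
    by (simp only: conn_coeff_def[symmetric] 2)
qed

text \<open>A frame field has constant components, so the derivative part vanishes; the rest is
  tensorial in the direction, and \<open>conn_frame\<close> is zero in vertical directions. It
  disposes of the bracket term of the curvature.\<close>

lemma cartan_nabla_vertical_frame:
  assumes "coframe h s Time p (X p) = 0" "\<And>i. coframe h s (Hor i) p (X p) = 0"
  shows "cartan_nabla h s X (frame h s A) p = 0"
  using assms
  by (simp add: cartan_nabla_def coframe_frame dir_deriv_def sum_adapted del: coframe.simps frame.simps)

section \<open>Differentiability of the adapted fields, and their brackets\<close>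

lemma differentiable_vec_lambda:
  fixes f :: "'n::finite \<Rightarrow> 'a::real_normed_vector \<Rightarrow> real"
  assumes "\<And>i. f i differentiable (at x within S)"
  shows "(\<lambda>p. \<chi> i. f i p) differentiable (at x within S)"
proof -
  have "(\<lambda>p. \<chi> i. f i p) = (\<lambda>p. \<Sum>i\<in>UNIV. f i p *\<^sub>R axis i 1)"
    by (simp add: vec_eq_iff fun_eq_iff axis_def if_distrib cong: if_cong)
  then show ?thesis
    using assms by (simp add: differentiable_sum differentiable_scaleR)
qed

lemma differentiable_Pair:
  assumes "f differentiable (at x within S)" "g differentiable (at x within S)"
  shows "(\<lambda>p. (f p, g p)) differentiable (at x within S)"
  using has_derivative_Pair[of f _ x S g] assms unfolding differentiable_def by blast

lemma frechet_derivative_in_kernel: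
  assumes "Y differentiable (at p)" "bounded_linear \<pi>" "\<And>q. \<pi> (Y q) = c"
  shows "\<pi> (frechet_derivative Y (at p) v) = 0"
proof -
  have "((\<lambda>q. \<pi> (Y q)) has_derivative (\<lambda>v. \<pi> (frechet_derivative Y (at p) v))) (at p)"
    using assms(1) unfolding frechet_derivative_works by (rule bounded_linear.has_derivative[OF assms(2)])
  then have "((\<lambda>q. c) has_derivative (\<lambda>v. \<pi> (frechet_derivative Y (at p) v))) (at p)"
    by (simp add: assms(3))
  from has_derivative_unique[OF this has_derivative_const] show ?thesis
    by metis
qed

lemma bounded_linear_coframe: "bounded_linear (coframe h s A p)"
  using linear_coframe linear_conv_bounded_linear by blast

text \<open>The bracket is a difference of derivatives of frame fields, and the time and horizontal
  components of a frame field are constant, so their derivatives vanish.\<close>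

lemma lie_bracket_frame_vertical:
  assumes "frame h s A differentiable (at p)" "frame h s B differentiable (at p)"
  shows "coframe h s Time p (lie_bracket (frame h s A) (frame h s B) p) = 0"
    and "coframe h s (Hor i) p (lie_bracket (frame h s A) (frame h s B) p) = 0"
proof -
  \<comment> \<open>The covectors dt and dx are the same at all points, so a covector at
    \<open>p\<close> may be paired with a frame vector at another point \<open>q\<close>. The
    vertical covectors depend on the point and are excluded.\<close>
  have dual: "coframe h s D p (frame h s C q) = (if D = C then 1 else 0)"
    if "D \<notin> range Ver" for D C q
    using that by (cases D; cases C) (auto simp: axis_def)
  have *: "coframe h s D p (frechet_derivative (frame h s C) (at p) v) = 0"
    if "D \<notin> range Ver" "frame h s C differentiable (at p)" for D C v
    by (rule frechet_derivative_in_kernel[OF that(2) bounded_linear_coframe dual[OF that(1)]])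
  show "coframe h s Time p (lie_bracket (frame h s A) (frame h s B) p) = 0"
    unfolding lie_bracket_def coframe_diff by (subst (1 2) *) (auto simp: assms)
  show "coframe h s (Hor i) p (lie_bracket (frame h s A) (frame h s B) p) = 0"
    unfolding lie_bracket_def coframe_diff by (subst (1 2) *) (auto simp: assms)
qed

lemma differentiable_comp:
  assumes "g differentiable (at p)" "f differentiable (at (g p))"
  shows "(\<lambda>q. f (g q)) differentiable (at p)"
  using differentiable_chain_at[OF assms] by (simp add: o_def)

lemma differentiable_fst: "fst differentiable F" and differentiable_snd: "snd differentiable F"
  by (auto intro: bounded_linear_imp_differentiable bounded_linear_fst bounded_linear_snd)

lemma differentiable_vec_nth: "(\<lambda>y. y $ i) differentiable F"
  by (intro bounded_linear_imp_differentiable bounded_linear_vec_nth)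

lemma kap_differentiable:
  assumes "smooth_map_on h UNIV" "\<forall>t. h t > 0"
  shows "kap h differentiable (at t)"
proof -
  have d: "h differentiable (at t)" for t
    by (rule smooth_map_on_differentiable[OF assms(1)]) simp
  \<comment> \<open>Smoothness is phrased through Frechet derivatives, so \<open>deriv h\<close> is
    rewritten as the one in direction 1.\<close>
  have "deriv h = (\<lambda>t. frechet_derivative h (at t) 1)"
  proof
    fix t
    have "(h has_derivative (*) (deriv h t)) (at t)"
      using d DERIV_deriv_iff_real_differentiable has_field_derivative_def by blast
    from frechet_derivative_at[OF this]
    show "deriv h t = frechet_derivative h (at t) 1" by (metis mult.right_neutral)
  qed
  then have "deriv h differentiable (at t)"
    using smooth_map_on_differentiable[OF smooth_map_on_frechet_derivative[OF assms(1)], of t 1]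
    by simp
  moreover have "h t \<noteq> 0" using assms(2) by (metis less_irrefl)
  ultimately show ?thesis
    unfolding kap_def[abs_def] using d
    by (intro differentiable_mult differentiable_divide differentiable_const) auto
qed

lemma s1_differentiable:
  assumes "smooth_map_on s U" "x \<in> U"
  shows "s1 s i differentiable (at x)"
  using smooth_map_on_differentiable[OF smooth_map_on_frechet_derivative[OF assms(1)] assms(2)]
  by (simp add: s1_def pdiff_def[abs_def])

text \<open>The components are affine in y, with coefficients built from \<open>kap\<close> and the
  first partials of \<open>s\<close>. Differentiability is what ties the value of
  \<open>frechet_derivative\<close> in the bracket to an actual derivative.\<close>

lemma frame_differentiable:
  assumes "smooth_map_on h UNIV" "\<forall>t. h t > 0" "smooth_map_on s U" "x \<in> U"
  shows "frame h s A differentiable (at (t, x, y))"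
proof -
  let ?p = "(t, x, y)"
  have s1: "s1 s i differentiable (at x)" for i
    by (rule s1_differentiable[OF assms(3,4)])
  have pt: "fst differentiable (at ?p)" by (rule differentiable_fst)
  have px: "(\<lambda>q. fst (snd q)) differentiable (at ?p)"
    by (rule differentiable_comp[OF differentiable_snd differentiable_fst])
  have py: "(\<lambda>q. snd (snd q) $ i) differentiable (at ?p)" for i
    by (rule differentiable_comp[OF differentiable_comp[OF differentiable_snd differentiable_snd] differentiable_vec_nth])
  have s1p: "(\<lambda>q. s1 s i (fst (snd q))) differentiable (at ?p)" for i
    by (rule differentiable_comp[OF px]) (simp add: s1)
  have kp: "(\<lambda>q. kap h (fst q)) differentiable (at ?p)"
    by (rule differentiable_comp[OF pt]) (rule kap_differentiable[OF assms(1,2)])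
  show ?thesis
  proof (cases A)
    case Time
    have "frame h s Time = (\<lambda>p. (1, 0, - (\<chi> i. M_conn h i p)))" by auto
    moreover have "M_conn h i differentiable (at ?p)" for i
      unfolding M_conn_def case_prod_beta using kp py by simp
    ultimately show ?thesis unfolding Time
      by (auto intro!: differentiable_Pair differentiable_vec_lambda differentiable_minus)
  next
    case (Hor j)
    have "frame h s (Hor j) = (\<lambda>p. (0, axis j 1, - (\<chi> i. N_conn s i j p)))" by auto
    moreover have "N_conn s i j differentiable (at ?p)" for i
      unfolding N_conn_def case_prod_beta divD_def S11_def using s1p py by simp
    ultimately show ?thesis unfolding Hor
      by (auto intro!: differentiable_Pair differentiable_vec_lambda differentiable_minus)
  next
    case (Ver j)
    have "frame h s (Ver j) = (\<lambda>p. (0, 0, axis j 1))" by auto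
    then show ?thesis unfolding Ver by simp
  qed
qed

text \<open>The classical formula of derivatives and products of connection coefficients, contracted
  over \<open>E\<close>. No bracket term appears, since brackets of frame fields are
  vertical.\<close>

lemma Ric_comp_eq:
  assumes "\<And>A. frame h s A differentiable (at p)"
  shows "Ric_comp h s A B p = (\<Sum>E\<in>UNIV.
      dir_deriv (frame h s E) (conn_coeff h s B A E) p
    - dir_deriv (frame h s B) (conn_coeff h s E A E) p
    + (\<Sum>C\<in>UNIV. conn_coeff h s B A C p * conn_coeff h s E C E p
                   - conn_coeff h s E A C p * conn_coeff h s B C E p))"
proof -
  have nabla: "cartan_nabla h s (frame h s E) (frame h s A) = conn_frame h s E A" for E A
    by (simp add: fun_eq_iff cartan_nabla_frame)
  have bracket: "cartan_nabla h s (lie_bracket (frame h s E) (frame h s B)) (frame h s A) p = 0" for E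
    by (rule cartan_nabla_vertical_frame) (rule lie_bracket_frame_vertical[OF assms assms])+
  have "coframe h s E p (curvature h s (frame h s E) (frame h s B) (frame h s A) p) =
      dir_deriv (frame h s E) (conn_coeff h s B A E) p
    - dir_deriv (frame h s B) (conn_coeff h s E A E) p
    + (\<Sum>C\<in>UNIV. conn_coeff h s B A C p * conn_coeff h s E C E p
                   - conn_coeff h s E A C p * conn_coeff h s B C E p)" for E
    unfolding curvature_def nabla bracket coframe_diff cartan_nabla_conn_frame coframe_zero sum_subtractf
    by simp
  then show ?thesis
    by (simp only: Ric_comp_def trace_def vec_lambda_beta)
qed

section \<open>Derivatives of functions that depend on t or on x alone\<close>

lemma dir_deriv_const: "dir_deriv X (\<lambda>p. c) p = 0"
  by (simp add: dir_deriv_def)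

lemma dir_deriv_time:
  assumes "c differentiable (at (fst p))"
  shows "dir_deriv X (\<lambda>q. c (fst q)) p = frechet_derivative c (at (fst p)) (fst (X p))"
proof -
  have "(c has_derivative frechet_derivative c (at (fst p))) (at (fst p))"
    using assms frechet_derivative_works by blast
  from diff_chain_at[OF bounded_linear_imp_has_derivative[OF bounded_linear_fst] this]
  have "((\<lambda>q. c (fst q)) has_derivative (\<lambda>v. frechet_derivative c (at (fst p)) (fst v))) (at p)"
    by (simp add: o_def)
  then show ?thesis
    by (simp add: dir_deriv_def frechet_derivative_at[symmetric])
qed

lemma dir_deriv_space:
  assumes "c differentiable (at (fst (snd p)))"
  shows "dir_deriv X (\<lambda>q. c (fst (snd q))) p = frechet_derivative c (at (fst (snd p))) (fst (snd (X p)))"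
proof -
  have b: "bounded_linear (\<lambda>q::jet1. fst (snd q))"
    by (intro bounded_linear_intros)
  have "(c has_derivative frechet_derivative c (at (fst (snd p)))) (at (fst (snd p)))"
    using assms frechet_derivative_works by blast
  from diff_chain_at[OF bounded_linear_imp_has_derivative[OF b] this]
  have "((\<lambda>q. c (fst (snd q))) has_derivative (\<lambda>v. frechet_derivative c (at (fst (snd p))) (fst (snd v)))) (at p)"
    by (simp add: o_def)
  then show ?thesis
    by (simp add: dir_deriv_def frechet_derivative_at[symmetric])
qed

section \<open>The Ricci tensor of the conformally flat metric\<close>

section \<open>The Ricci d-tensor\<close>

text \<open>Shaped as an induction rule so that \<open>induct\<close> performs the four-way split of
  an index.\<close>

lemma induct_4: "P 1 \<Longrightarrow> P 2 \<Longrightarrow> P 3 \<Longrightarrow> P 4 \<Longrightarrow> P (a::4)"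
  using exhaust_4[of a] by auto

lemma s2_commute:
  assumes "smooth_map_on s U" "open U" "x \<in> U"
  shows "s2 s i j x = s2 s j i x"
  using symmetric_second_frechet_derivative[OF assms(2,3,1)]
  by (simp add: s2_def pdiff_def[abs_def])

lemma L_coeff_has_derivative:
  assumes "smooth_map_on s U" "x \<in> U"
  defines "D m \<equiv> frechet_derivative (s1 s m) (at x)"
  shows "(L_coeff s i j k has_derivative
    (\<lambda>v. kron i j * D k v + kron i k * D j v + (1 - kron j k) * D i v
        - (1 - kron j k) / 3 * (D 1 v + D 2 v + D 3 v + D 4 v))) (at x)"
proof -
  have [derivative_intros]: "(s1 s m has_derivative D m) (at x)" for m
    using s1_differentiable[OF assms(1,2)] by (simp add: D_def frechet_derivative_works)
  show ?thesis
    unfolding L_coeff_def[abs_def] divD_def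
    by (auto intro!: derivative_eq_intros)
qed

lemma pdiff_L_coeff:
  assumes "smooth_map_on s U" "x \<in> U"
  shows "pdiff l (L_coeff s i j k) x =
    kron i j * s2 s l k x + kron i k * s2 s l j x + (1 - kron j k) * s2 s l i x
        - (1 - kron j k) / 3 * (s2 s l 1 x + s2 s l 2 x + s2 s l 3 x + s2 s l 4 x)"
  unfolding pdiff_def frechet_derivative_at[OF L_coeff_has_derivative[OF assms], symmetric]
  by (simp add: s2_def pdiff_def[abs_def] s1_def)

text \<open>The trace of Christoffel symbols is the derivative of the logarithm of the volume
  density, which here is a constant times \<open>exp (4 * s x)\<close>.\<close>

lemma L_coeff_trace: "(\<Sum>e\<in>UNIV. L_coeff s e a e x) = 4 * s1 s a x"
  by (induct a rule: induct_4; simp add: L_coeff_def kron_def sum_4 divD_def add_divide_distrib)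

text \<open>This is the formula for the Ricci tensor under a conformal change of a flat metric in
  dimension 4. The four groups of terms are evaluated separately, by cases on the free
  indices.\<close>

lemma L_coeff_Ricci_contraction:
  assumes "smooth_map_on s U" "open U" "x \<in> U"
  shows "(\<Sum>e\<in>UNIV. pdiff e (L_coeff s e a b) x - pdiff b (L_coeff s e a e) x
      + (\<Sum>c\<in>UNIV. L_coeff s c a b x * L_coeff s e c e x - L_coeff s c a e x * L_coeff s e c b x))
    = R_low s a b x"
proof -
  note sym = s2_commute[OF assms]
  define d where "d = divD s x / 3"
  have L: "L_coeff s i j k x = (if j = k then if i = j then 2 * s1 s j x else 0
      else s1 s i x - d + (if i = j then s1 s k x else 0) + (if i = k then s1 s j x else 0))" for i j k
    by (simp add: L_coeff_def kron_def d_def)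
  have 1: "(\<Sum>e\<in>UNIV. pdiff b (L_coeff s e a e) x) = 4 * s2 s b a x"
    by (induct a rule: induct_4; simp add: pdiff_L_coeff[OF assms(1,3)] kron_def sum_4 add_divide_distrib)
  have 2: "(\<Sum>e\<in>UNIV. \<Sum>c\<in>UNIV. L_coeff s c a b x * L_coeff s e c e x)
      = (\<Sum>c\<in>UNIV. L_coeff s c a b x * (4 * s1 s c x))"
    by (subst sum.swap) (simp only: L_coeff_trace flip: sum_distrib_left)
  have 3: "(\<Sum>e\<in>UNIV. pdiff e (L_coeff s e a b) x) = s2 s a b x + s2 s b a x
      + (1 - kron a b) * (Lap s x - SS s x / 3)"
    by (induct a rule: induct_4; induct b rule: induct_4;
      simp add: pdiff_L_coeff[OF assms(1,3)] kron_def sum_4 Lap_def SS_def;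
      simp add: sym[of 2 1] sym[of 3 1] sym[of 4 1] sym[of 3 2] sym[of 4 2] sym[of 4 3] add_divide_distrib)
  have 4: "(\<Sum>c\<in>UNIV. L_coeff s c a b x * (4 * s1 s c x))
     - (\<Sum>e\<in>UNIV. \<Sum>c\<in>UNIV. L_coeff s c a e x * L_coeff s e c b x)
     = 2 * s1 s a x * s1 s b x + (1 - kron a b) * (2 * grad_sq s x - 6 * d\<^sup>2)"
  proof -
    \<comment> \<open>Eliminating the fourth partial in favour of \<open>d\<close> leaves a
      polynomial identity in independent quantities, free of the divergence.\<close>
    have "s1 s 4 x = 3 * d - s1 s 1 x - s1 s 2 x - s1 s 3 x"
      by (simp add: d_def divD_def add_divide_distrib)
    then show ?thesis
      by (induct a rule: induct_4; induct b rule: induct_4;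
        simp add: L kron_def sum_4 grad_sq_def; simp add: algebra_simps power2_eq_square)
  qed
  \<comment> \<open>Symmetry of the Hessian turns
    \<open>s2 s a b x + s2 s b a x - 4 * s2 s b a x\<close> into
    \<open>- 2 * s2 s a b x\<close>.\<close>
  show ?thesis
    unfolding sum.distrib sum_subtractf 1 2 3 using 4
    by (simp add: R_low_def sym[of b a] d_def power2_eq_square field_simps)
qed

lemma dir_deriv_L_coeff:
  assumes "smooth_map_on s U" "x \<in> U"
  shows "dir_deriv (frame h s (Hor l)) (\<lambda>q. L_coeff s i j k (fst (snd q))) (t, x, y) = pdiff l (L_coeff s i j k) x"
    and "dir_deriv (frame h s Time) (\<lambda>q. L_coeff s i j k (fst (snd q))) (t, x, y) = 0"
    and "dir_deriv (frame h s (Ver l)) (\<lambda>q. L_coeff s i j k (fst (snd q))) (t, x, y) = 0"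
proof -
  have d: "L_coeff s i j k differentiable (at x)"
    using L_coeff_has_derivative[OF assms] differentiableI by blast
  note dd = dir_deriv_space[of _ "(t, x, y)", simplified, OF d]
  show "dir_deriv (frame h s (Hor l)) (\<lambda>q. L_coeff s i j k (fst (snd q))) (t, x, y) = pdiff l (L_coeff s i j k) x"
    by (simp add: dd pdiff_def)
  show "dir_deriv (frame h s Time) (\<lambda>q. L_coeff s i j k (fst (snd q))) (t, x, y) = 0"
    and "dir_deriv (frame h s (Ver l)) (\<lambda>q. L_coeff s i j k (fst (snd q))) (t, x, y) = 0"
    using linear_frechet_derivative[OF d] by (simp_all add: dd linear_0)
qed

text \<open>The last two forms cover the coefficients \<open>- kap h (fst p) * kron i j\<close>
  after simplification. The time derivative of \<open>kap\<close> enters the Ricci components only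
  for the pair (\<open>Time\<close>, \<open>Time\<close>), where it cancels.\<close>

lemma dir_deriv_kap:
  assumes "smooth_map_on h UNIV" "\<forall>t. h t > 0"
  shows "dir_deriv (frame h s (Hor l)) (\<lambda>q. kap h (fst q)) (t, x, y) = 0"
    and "dir_deriv (frame h s (Ver l)) (\<lambda>q. kap h (fst q)) (t, x, y) = 0"
    and "dir_deriv (frame h s (Hor l)) (\<lambda>q. - (kap h (fst q) * c)) (t, x, y) = 0"
    and "dir_deriv (frame h s (Ver l)) (\<lambda>q. - (kap h (fst q) * c)) (t, x, y) = 0"
proof -
  have d: "(\<lambda>t. a * kap h t) differentiable (at t)" for a
    using kap_differentiable[OF assms, of t] by simp
  note dd = dir_deriv_time[of _ "(t, x, y)", simplified, OF d]
  have "dir_deriv (frame h s (Hor l)) (\<lambda>q. a * kap h (fst q)) (t, x, y) = 0"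
    "dir_deriv (frame h s (Ver l)) (\<lambda>q. a * kap h (fst q)) (t, x, y) = 0" for a
    using linear_frechet_derivative[OF d] by (simp_all add: dd linear_0)
  from this[of 1] this[of "- c"]
  show "dir_deriv (frame h s (Hor l)) (\<lambda>q. kap h (fst q)) (t, x, y) = 0"
    and "dir_deriv (frame h s (Ver l)) (\<lambda>q. kap h (fst q)) (t, x, y) = 0"
    and "dir_deriv (frame h s (Hor l)) (\<lambda>q. - (kap h (fst q) * c)) (t, x, y) = 0"
    and "dir_deriv (frame h s (Ver l)) (\<lambda>q. - (kap h (fst q) * c)) (t, x, y) = 0"
    by (simp_all add: mult.commute)
qed

lemma Ric_comp_Hor_Hor:
  assumes "smooth_map_on h UNIV" "\<forall>t. h t > 0" "smooth_map_on s U" "open U" "x \<in> U"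
  shows "Ric_comp h s (Hor a) (Hor b) (t, x, y) = R_low s a b x"
  using L_coeff_Ricci_contraction[OF assms(3-5)]
  by (simp add: Ric_comp_eq[OF frame_differentiable[OF assms(1-3,5)]] sum_adapted dir_deriv_const
      dir_deriv_L_coeff[OF assms(3,5)] del: frame.simps)

text \<open>The connection preserves the type of a frame field, so the contraction only involves
  directions \<open>E\<close> of the type of \<open>A\<close>, apart from derivatives along
  \<open>B\<close>. Vertical directions have zero coefficients and kill functions of t and x. If
  \<open>A\<close> is \<open>Time\<close>, the contraction is one-dimensional, and
  \<open>kap\<close> has zero derivative off the time direction. If only \<open>A\<close> is
  horizontal, what remains is a derivative of a function of x along a field with no
  x-component.\<close>

lemma Ric_comp_eq_0:
  assumes "smooth_map_on h UNIV" "\<forall>t. h t > 0" "smooth_map_on s U" "x \<in> U"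
    and "A \<notin> range Hor \<or> B \<notin> range Hor"
  shows "Ric_comp h s A B (t, x, y) = 0"
  using assms(5)
  by (cases A; cases B)
     (simp_all add: Ric_comp_eq[OF frame_differentiable[OF assms(1-4)]] sum_adapted dir_deriv_const
      dir_deriv_L_coeff[OF assms(3,4)] dir_deriv_kap[OF assms(1,2)] del: frame.simps)

section \<open>The inverse potential and the scalar curvature\<close>

section \<open>Einstein equations\<close>

text \<open>\<open>matrix_inv\<close> is a choice among two-sided inverses; a right inverse of a
  square matrix is two-sided, and the chosen inverse must agree with it.\<close>

lemma matrix_inv_eqI:
  fixes M N :: "real^'n^'n"
  assumes "M ** N = mat 1"
  shows "matrix_inv M = N"
proof -
  have NM: "N ** M = mat 1" using assms matrix_left_right_inverse by blast
  have "M ** matrix_inv M = mat 1 \<and> matrix_inv M ** M = mat 1"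
    unfolding matrix_inv_def
    by (rule someI[of "\<lambda>A'. M ** A' = mat 1 \<and> A' ** M = mat 1" N]) (simp add: assms NM)
  then have "matrix_inv M = (N ** M) ** matrix_inv M" and "M ** matrix_inv M = mat 1"
    by (simp_all add: NM)
  then show ?thesis by (simp flip: matrix_mul_assoc)
qed

lemma grav_pot_frame:
  "grav_pot h s p (frame h s Time p) (frame h s Time p) = h (fst p)"
  "grav_pot h s p (frame h s (Hor i) p) (frame h s (Hor j) p) = g_low h s i j p"
  "grav_pot h s p (frame h s (Ver i) p) (frame h s (Ver j) p) = 1 / h (fst p) * g_low h s i j p"
  "grav_pot h s p (frame h s Time p) (frame h s (Hor j) p) = 0"
  "grav_pot h s p (frame h s Time p) (frame h s (Ver j) p) = 0"
  "grav_pot h s p (frame h s (Hor i) p) (frame h s Time p) = 0"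
  "grav_pot h s p (frame h s (Ver i) p) (frame h s Time p) = 0"
  "grav_pot h s p (frame h s (Hor i) p) (frame h s (Ver j) p) = 0"
  "grav_pot h s p (frame h s (Ver i) p) (frame h s (Hor j) p) = 0"
  by (simp_all add: grav_pot_def coframe_frame if_distrib[of "\<lambda>x. _ * x"] if_distrib[of "\<lambda>x. x * _"]
      del: coframe.simps frame.simps cong: if_cong)

lemma grav_pot_expansion:
  "grav_pot h s p u v = (\<Sum>A\<in>UNIV. \<Sum>B\<in>UNIV. grav_pot h s p (frame h s A p) (frame h s B p)
     * coframe h s A p u * coframe h s B p v)"
  by (simp add: sum_adapted grav_pot_frame del: coframe.simps frame.simps)
     (simp add: grav_pot_def del: coframe.simps)

lemma Ric_frame: "Ric h s p (frame h s A p) (frame h s B p) = Ric_comp h s A B p"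
  by (simp add: Ric_def coframe_frame if_distrib[of "\<lambda>x. _ * x"] if_distrib[of "\<lambda>x. x * _"]
      del: coframe.simps frame.simps cong: if_cong)

lemma bilinear_frame_expansion:
  assumes "bilinear f"
  shows "f u v = (\<Sum>A\<in>UNIV. \<Sum>B\<in>UNIV. f (frame h s A p) (frame h s B p)
     * coframe h s A p u * coframe h s B p v :: real)"
proof -
  have "f u v = f (\<Sum>A\<in>UNIV. coframe h s A p u *\<^sub>R frame h s A p) (\<Sum>B\<in>UNIV. coframe h s B p v *\<^sub>R frame h s B p)"
    by (simp only: frame_expansion[symmetric])
  also have "\<dots> = (\<Sum>(A, B)\<in>UNIV \<times> UNIV. f (coframe h s A p u *\<^sub>R frame h s A p) (coframe h s B p v *\<^sub>R frame h s B p))"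
    by (rule bilinear_sum[OF assms])
  also have "\<dots> = (\<Sum>A\<in>UNIV. \<Sum>B\<in>UNIV. f (coframe h s A p u *\<^sub>R frame h s A p) (coframe h s B p v *\<^sub>R frame h s B p))"
    by (rule sum.cartesian_product[symmetric])
  also have "\<dots> = (\<Sum>A\<in>UNIV. \<Sum>B\<in>UNIV. f (frame h s A p) (frame h s B p) * coframe h s A p u * coframe h s B p v)"
    by (simp add: bilinear_lmul[OF assms] bilinear_rmul[OF assms] mult_ac del: coframe.simps frame.simps)
  finally show ?thesis .
qed

text \<open>With J the all-ones matrix of size 4, J J = 4 J, hence (J - I)(J/3 - I) = I.\<close>

lemma Minkowski_inverse:
  "(\<Sum>k\<in>UNIV. (1 - kron i k) * (1 / 3 - kron k j)) = kron i j"
  by (induct i rule: induct_4; induct j rule: induct_4; simp add: kron_def sum_4)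

lemma matrix_inv_grav_pot:
  assumes "h t > 0" "G11 y > 0"
  shows "matrix_inv (grav_pot_matrix h s (t, x, y)) = (\<chi> A B. case (A, B) of
      (Time, Time) \<Rightarrow> 1 / h t
    | (Hor i, Hor j) \<Rightarrow> 2 * exp (- 2 * s x) * (1 / 3 - kron i j)
    | (Ver i, Ver j) \<Rightarrow> h t * (2 * exp (- 2 * s x) * (1 / 3 - kron i j))
    | _ \<Rightarrow> 0)"
proof (rule matrix_inv_eqI)
  let ?N = "\<chi> A B. case (A, B) of
      (Time, Time) \<Rightarrow> 1 / h t
    | (Hor i, Hor j) \<Rightarrow> 2 * exp (- 2 * s x) * (1 / 3 - kron i j)
    | (Ver i, Ver j) \<Rightarrow> h t * (2 * exp (- 2 * s x) * (1 / 3 - kron i j))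
    | _ \<Rightarrow> 0"
  have e: "exp (2 * s x) * exp (- 2 * s x) = 1"
    by (simp flip: exp_add)
  have "g_low h s i k (t, x, y) * (2 * exp (- 2 * s x) * (1 / 3 - kron k j))
      = (exp (2 * s x) * exp (- 2 * s x)) * ((1 - kron i k) * (1 / 3 - kron k j))" for i j k
    unfolding g_low_eq[where h = h and t = t, OF assms] by simp
  then have g: "(\<Sum>k\<in>UNIV. g_low h s i k (t, x, y) * (2 * exp (- 2 * s x) * (1 / 3 - kron k j))) = kron i j" for i j
    unfolding e by (simp only: mult_1 Minkowski_inverse)
  \<comment> \<open>The factors of \<open>h t\<close> cancel, which reduces the vertical block to
    the horizontal one.\<close>
  have "1 / h t * a * (h t * b) = a * b" for a b
    using assms(1) by simp
  then have g': "(\<Sum>k\<in>UNIV. 1 / h t * g_low h s i k (t, x, y) * (h t * (2 * exp (- 2 * s x) * (1 / 3 - kron k j)))) = kron i j" for i j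
    by (simp only: g)
  show "grav_pot_matrix h s (t, x, y) ** ?N = mat 1"
  proof (intro vec_eq_iff[THEN iffD2] allI)
    fix A B
    show "(grav_pot_matrix h s (t, x, y) ** ?N) $ A $ B = mat 1 $ A $ B"
      unfolding matrix_matrix_mult_def grav_pot_matrix_def mat_def vec_lambda_beta sum_adapted
      using assms(1)
      by (cases A; cases B) (simp_all only: grav_pot_frame adapted.case prod.case g g' fst_conv
          adapted.simps mult_zero_left mult_zero_right sum.neutral_const add_0_left add_0_right, simp_all add: kron_def)
  qed
qed

lemma Minkowski_scalar:
  "(\<Sum>i\<in>UNIV. \<Sum>j\<in>UNIV. (1 / 3 - kron i j) * R_low s i j x)
    = 2 * (3 * Lap s x + 3 * grad_sq s x - (divD s x)\<^sup>2 - SS s x)"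
proof -
  define c where "c = (3 * Lap s x + 6 * grad_sq s x - 2 * (divD s x)\<^sup>2 - SS s x) / 3"
  have d: "(divD s x)\<^sup>2 = (\<Sum>i\<in>UNIV. \<Sum>j\<in>UNIV. s1 s i x * s1 s j x)"
    by (simp add: divD_def sum_4 power2_eq_square algebra_simps)
  have R: "R_low s i j x = - 2 * (s2 s i j x - s1 s i x * s1 s j x) + (1 - kron i j) * c" for i j
    by (simp add: R_low_def c_def)
  \<comment> \<open>The coefficient 4 of \<open>c\<close> is the dimension: the matrix
    \<open>1 - kron i j\<close> is contracted with its own inverse.\<close>
  have "(\<Sum>i\<in>UNIV. \<Sum>j\<in>UNIV. (1 / 3 - kron i j) * R_low s i j x)
    = - 2 / 3 * (SS s x - (divD s x)\<^sup>2) + 2 * (Lap s x - grad_sq s x) + 4 * c"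
    unfolding R d SS_def Lap_def grad_sq_def
    by (simp add: sum_4 kron_def power2_eq_square algebra_simps add_divide_distrib)
  also have "\<dots> = 2 * (3 * Lap s x + 3 * grad_sq s x - (divD s x)\<^sup>2 - SS s x)"
    by (simp add: c_def field_simps)
  finally show ?thesis .
qed

text \<open>Only the horizontal block of the Ricci tensor is nonzero, so only the horizontal block
  of the inverse potential contributes.\<close>

lemma Sc_eq_R_scal:
  assumes "smooth_map_on h UNIV" "\<forall>t. h t > 0" "smooth_map_on s U" "open U" "x \<in> U" "G11 y > 0"
  shows "Sc h s (t, x, y) = R_scal s x"
proof -
  note R0 = Ric_comp_eq_0[OF assms(1-3,5)]
  have h: "h t > 0" using assms(2) by blast
  have "Sc h s (t, x, y) = (\<Sum>i\<in>UNIV. \<Sum>j\<in>UNIV. 2 * exp (- 2 * s x) * (1 / 3 - kron i j) * R_low s i j x)"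
    unfolding Sc_def matrix_inv_grav_pot[of h t, OF h assms(6)]
    by (simp add: sum_adapted R0 image_iff Ric_comp_Hor_Hor[OF assms(1-5)])
  also have "\<dots> = 2 * exp (- 2 * s x) * (\<Sum>i\<in>UNIV. \<Sum>j\<in>UNIV. (1 / 3 - kron i j) * R_low s i j x)"
    by (simp add: sum_distrib_left mult.assoc)
  also have "\<dots> = R_scal s x"
    by (simp add: Minkowski_scalar R_scal_def)
  finally show ?thesis .
qed

section \<open>From the global equation to its adapted components\<close>

lemma forall_adapted: "(\<forall>A. P A) \<longleftrightarrow> P Time \<and> (\<forall>i. P (Hor i)) \<and> (\<forall>i. P (Ver i))"
  by (metis adapted.exhaust)

lemma Einstein_equation_components:
  assumes "bilinear (T p)"
  shows "(\<forall>u v. Ric h s p u v - Sc h s p / 2 * grav_pot h s p u v = K * T p u v) \<longleftrightarrow>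
    (\<forall>A B. Ric_comp h s A B p - Sc h s p / 2 * grav_pot h s p (frame h s A p) (frame h s B p)
      = K * T p (frame h s A p) (frame h s B p))"
    (is "_ \<longleftrightarrow> (\<forall>A B. ?R A B - ?c * ?G A B = K * ?T A B)")
proof
  assume "\<forall>u v. Ric h s p u v - Sc h s p / 2 * grav_pot h s p u v = K * T p u v"
  then show "\<forall>A B. ?R A B - ?c * ?G A B = K * ?T A B"
    by (metis Ric_frame)
next
  assume comp: "\<forall>A B. ?R A B - ?c * ?G A B = K * ?T A B"
  show "\<forall>u v. Ric h s p u v - Sc h s p / 2 * grav_pot h s p u v = K * T p u v"
  proof (intro allI)
    fix u v
    have "Ric h s p u v - ?c * grav_pot h s p u v = (\<Sum>A\<in>UNIV. \<Sum>B\<in>UNIV.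
        (?R A B - ?c * ?G A B) * coframe h s A p u * coframe h s B p v)"
      unfolding Ric_def grav_pot_expansion[of h s p u v] sum_distrib_left sum_subtractf[symmetric]
      by (simp only: left_diff_distrib mult.assoc)
    also have "\<dots> = (\<Sum>A\<in>UNIV. \<Sum>B\<in>UNIV. (K * ?T A B) * coframe h s A p u * coframe h s B p v)"
      by (simp only: comp)
    also have "\<dots> = K * T p u v"
      unfolding bilinear_frame_expansion[OF assms, of u v h s p] sum_distrib_left
      by (simp only: mult.assoc)
    finally show "Ric h s p u v - ?c * grav_pot h s p u v = K * T p u v" .
  qed
qed

theorem proposition4p3:
  fixes \<A> :: "'m::{t2_space, second_countable_topology} chart set"
    and V :: "'m set" and \<phi> :: "'m \<Rightarrow> real^4" and U :: "(real^4) set"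
    and \<sigma> :: "'m \<Rightarrow> real" and s :: "real^4 \<Rightarrow> real"
    and h :: "real \<Rightarrow> real" and K :: real
    and T :: "jet1 \<Rightarrow> jet1 \<Rightarrow> jet1 \<Rightarrow> real"
    and T_tt :: "jet1 \<Rightarrow> real"
    and T_tx T_xt T_yt T_ty :: "4 \<Rightarrow> jet1 \<Rightarrow> real"
    and T_xx T_xy T_yx T_yy :: "4 \<Rightarrow> 4 \<Rightarrow> jet1 \<Rightarrow> real"
  assumes "smooth_map_on h UNIV" and "\<forall>t. h t > 0"
    and "smooth_atlas \<A>" and "smooth_function \<A> \<sigma>" and "\<not> \<sigma> constant_on UNIV"
    and "(V, \<phi>) \<in> \<A>" and "U = \<phi> ` V" and "s = \<sigma> \<circ> inv_into V \<phi>"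
    and "K \<noteq> 0"
    and "\<forall>p\<in>jet_domain U. bilinear (T p)"
    and "\<forall>p\<in>jet_domain U. \<forall>u v. T p u v =
        (let dt = coframe h s Time p;
             dx = (\<lambda>i. coframe h s (Hor i) p);
             \<delta>y = (\<lambda>i. coframe h s (Ver i) p)
         in T_tt p * dt u * dt v
          + (\<Sum>i\<in>UNIV. T_tx i p * dt u * dx i v)
          + (\<Sum>i\<in>UNIV. T_xt i p * dx i u * dt v)
          + (\<Sum>i\<in>UNIV. \<Sum>j\<in>UNIV. T_xx i j p * dx i u * dx j v)
          + (\<Sum>i\<in>UNIV. T_yt i p * \<delta>y i u * dt v)
          + (\<Sum>i\<in>UNIV. T_ty i p * dt u * \<delta>y i v)
          + (\<Sum>i\<in>UNIV. \<Sum>j\<in>UNIV. T_xy i j p * dx i u * \<delta>y j v)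
          + (\<Sum>i\<in>UNIV. \<Sum>j\<in>UNIV. T_yx i j p * \<delta>y i u * dx j v)
          + (\<Sum>i\<in>UNIV. \<Sum>j\<in>UNIV. T_yy i j p * \<delta>y i u * \<delta>y j v))"
  shows "(\<forall>p\<in>jet_domain U. \<forall>u v.
            Ric h s p u v - Sc h s p / 2 * grav_pot h s p u v = K * T p u v)
     \<longleftrightarrow>
     (\<forall>(t, x, y)\<in>jet_domain U. \<forall>i j.
          R_low s i j x - R_scal s x / 2 * g_low h s i j (t, x, y) = K * T_xx i j (t, x, y)
        \<and> - R_scal s x * h t = 2 * K * T_tt (t, x, y)
        \<and> 0 = T_tx i (t, x, y)
        \<and> 0 = T_xt i (t, x, y)
        \<and> 0 = T_yt i (t, x, y)
        \<and> 0 = T_ty i (t, x, y)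
        \<and> 0 = T_xy i j (t, x, y)
        \<and> 0 = T_yx i j (t, x, y)
        \<and> - R_scal s x * (1 / h t) * g_low h s i j (t, x, y) = 2 * K * T_yy i j (t, x, y))"
proof -
  have chart: "open V" "open U" and cover: "smooth_map_on s U"
    using assms(3,4,6-8) unfolding smooth_atlas_def smooth_function_def by fastforce+
  have pointwise: "(\<forall>u v. Ric h s (t, x, y) u v - Sc h s (t, x, y) / 2 * grav_pot h s (t, x, y) u v
        = K * T (t, x, y) u v) \<longleftrightarrow>
     (\<forall>i j. R_low s i j x - R_scal s x / 2 * g_low h s i j (t, x, y) = K * T_xx i j (t, x, y)
        \<and> - R_scal s x * h t = 2 * K * T_tt (t, x, y)
        \<and> 0 = T_tx i (t, x, y)
        \<and> 0 = T_xt i (t, x, y)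
        \<and> 0 = T_yt i (t, x, y)
        \<and> 0 = T_ty i (t, x, y)
        \<and> 0 = T_xy i j (t, x, y)
        \<and> 0 = T_yx i j (t, x, y)
        \<and> - R_scal s x * (1 / h t) * g_low h s i j (t, x, y) = 2 * K * T_yy i j (t, x, y))"
    if p: "(t, x, y) \<in> jet_domain U" for t x y
  proof -
    let ?p = "(t, x, y)"
    have x: "x \<in> U" and y: "G11 y > 0" using p by (auto simp: jet_domain_def)
    have h: "h t \<noteq> 0" using assms(2) by (metis less_irrefl)
    \<comment> \<open>Duality of frame and coframe isolates one coefficient of the stress-energy
      tensor for each pair of frame fields.\<close>
    have T: "T ?p (frame h s A ?p) (frame h s B ?p) = (case (A, B) of
        (Time, Time) \<Rightarrow> T_tt ?p | (Time, Hor j) \<Rightarrow> T_tx j ?p | (Time, Ver j) \<Rightarrow> T_ty j ?p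
      | (Hor i, Time) \<Rightarrow> T_xt i ?p | (Hor i, Hor j) \<Rightarrow> T_xx i j ?p | (Hor i, Ver j) \<Rightarrow> T_xy i j ?p
      | (Ver i, Time) \<Rightarrow> T_yt i ?p | (Ver i, Hor j) \<Rightarrow> T_yx i j ?p | (Ver i, Ver j) \<Rightarrow> T_yy i j ?p)"
      for A B
      unfolding assms(11)[rule_format, OF p] Let_def coframe_frame
      by (cases A; cases B) (simp_all add: if_distrib[of "\<lambda>x. _ * x"] if_distrib[of "\<lambda>x. x * _"] cong: if_cong)
    note R = Ric_comp_Hor_Hor[OF assms(1,2) cover chart(2) x] Ric_comp_eq_0[OF assms(1,2) cover x]
      Sc_eq_R_scal[OF assms(1,2) cover chart(2) x y]
    \<comment> \<open>In the six mixed blocks the left side vanishes, and \<open>K\<close> being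
      nonzero gives a zero coefficient of \<open>T\<close>. In the time and vertical blocks only the
      scalar curvature term survives, and doubling gives the stated form.\<close>
    show ?thesis
      unfolding Einstein_equation_components[of T ?p h s K, OF assms(10)[rule_format, OF p]]
      unfolding R(3) T forall_adapted
      using \<open>K \<noteq> 0\<close>
      by (simp add: R(1,2) grav_pot_frame image_iff del: frame.simps) (auto simp: field_simps h)
  qed
  show ?thesis (is "(\<forall>p\<in>_. ?E p) \<longleftrightarrow> (\<forall>p\<in>_. ?L p)")
  proof (rule ball_cong[OF refl])
    fix p assume p: "p \<in> jet_domain U"
    obtain t x y where "p = (t, x, y)" by (cases p)
    with p show "?E p \<longleftrightarrow> ?L p"
      using pointwise[of t x y] by (simp only: prod.case)
  qed
qed

end
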